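(* Let $\boldsymbol{P}\in\mathbb{R}^{[3,n]}$. Then $$\mathcal{T}_L(\boldsymbol{P})=\frac12\max_{j,k_1,k_2}\sum_{i}|\boldsymbol{P}_{ijk_1}-\boldsymbol{P}_{ijk_2}|.$$ Moreover, if $\boldsymbol{P}$ is stochastic then $$\mathcal{T}_L(\boldsymbol{P})=1-\min_{j,k_1,k_2}\sum_i\min\{\boldsymbol{P}_{ijk_1},\boldsymbol{P}_{ijk_2}\} =1-\min_{\mathcal{I}\subset[n]}\min_j\Big(\min_{k_1}\sum_{i\notin\mathcal{I}}\boldsymbol{P}_{ijk_1}+\min_{k_2}\sum_{i\in\mathcal{I}}\boldsymbol{P}_{ijk_2}\Big).$$
   Context: $\mathbb{R}^{[3,n]}$ is the set of real $n\times n\times n$ arrays $\boldsymbol{P}=(\boldsymbol{P}_{ijk})$ (cubical tensors of order 3), $n\ge 2$. All indices range over $[n]=\{1,\dots,n\}$; $\mathcal{I}$ ranges over the subsets of $[n]$, and empty sums are $0$. $\boldsymbol{P}$ is called stochastic if $\boldsymbol{P}_{ijk}\ge 0$ for all $i,j,k$ and $\sum_{i=1}^n\boldsymbol{P}_{ijk}=1$ for all $j,k$. For $x,y\in\mathbb{R}^n$, $\boldsymbol{P}xy\in\mathbb{R}^n$ is the vector $(\boldsymbol{P}xy)_i=\sum_{j,k}\boldsymbol{P}_{ijk}x_jy_k$. Let $\mathcal{S}_1=\{x\in\mathbb{R}^n: x\ge 0,\ \|x\|_1=1\}$ and $\mathcal{Z}_1=\{x\in\mathbb{R}^n:\sum_i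 x_i=0,\ \|x\|_1=1\}$. The coefficient $\mathcal{T}_L$ is defined by $\mathcal{T}_L(\boldsymbol{P})=\max_{x\in\mathcal{S}_1}\max_{y\in\mathcal{Z}_1}\|\boldsymbol{P}xy\|_1$. *)

theory Defs
  imports "HOL-Analysis.Analysis"
begin

text \<open>
  The index set \<open>[n]\<close> is a finite type \<open>'n\<close> with \<open>n = CARD('n)\<close>, and
  \<open>P $ i $ j $ k\<close> is the entry with indices \<open>i, j, k\<close>.
\<close>

type_synonym 'n tensor3 = "real ^ 'n ^ 'n ^ 'n"

definition stochastic :: "'n::finite tensor3 \<Rightarrow> bool" where
  "stochastic P \<longleftrightarrow>
     (\<forall>i j k. 0 \<le> P $ i $ j $ k) \<and> (\<forall>j k. (\<Sum>i\<in>UNIV. P $ i $ j $ k) = 1)"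

definition tensor_app :: "'n::finite tensor3 \<Rightarrow> real ^ 'n \<Rightarrow> real ^ 'n \<Rightarrow> real ^ 'n" where
  "tensor_app P x y = (\<chi> i. \<Sum>j\<in>UNIV. \<Sum>k\<in>UNIV. P $ i $ j $ k * x $ j * y $ k)"

definition norm1 :: "real ^ 'n::finite \<Rightarrow> real" where
  "norm1 x = (\<Sum>i\<in>UNIV. \<bar>x $ i\<bar>)"

definition S1 :: "(real ^ 'n::finite) set" where
  "S1 = {x. (\<forall>i. 0 \<le> x $ i) \<and> norm1 x = 1}"

definition Z1 :: "(real ^ 'n::finite) set" where
  "Z1 = {x. (\<Sum>i\<in>UNIV. x $ i) = 0 \<and> norm1 x = 1}"

text \<open>
  A genuine maximum over a possibly infinite set: the largest element of the image, not
  merely its supremum (so it is an unspecified value if the maximum is not attained).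
\<close>

definition max_over :: "'a set \<Rightarrow> ('a \<Rightarrow> real) \<Rightarrow> real" where
  "max_over A f = (GREATEST v. v \<in> f ` A)"

definition T_L :: "'n::finite tensor3 \<Rightarrow> real" where
  "T_L P = max_over S1 (\<lambda>x. max_over Z1 (\<lambda>y. norm1 (tensor_app P x y)))"

text \<open>
  Both maxima in \<open>T_L\<close> are attained as soon as \<open>n \<ge> 2\<close>; for \<open>n = 1\<close> the set
  \<open>Z1\<close> is empty.
\<close>

lemma max_over_eqI:
  assumes "a \<in> A" and "\<And>x. x \<in> A \<Longrightarrow> f x \<le> f a"
  shows "max_over A f = f a"
  unfolding max_over_def by (rule Greatest_equality) (use assms in auto)

lemma compact_norm1_sphere: "compact {x :: real ^ 'n::finite. norm1 x = 1}"
proof (rule compact_eq_bounded_closed[THEN iffD2], intro conjI)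
  show "bounded {x :: real ^ 'n. norm1 x = 1}"
    unfolding bounded_iff norm1_def by (metis (mono_tags, lifting) mem_Collect_eq norm_le_l1_cart)
  show "closed {x :: real ^ 'n. norm1 x = 1}"
    unfolding norm1_def by (intro closed_Collect_eq continuous_intros)
qed

lemma compact_S1: "compact (S1 :: (real ^ 'n::finite) set)"
proof -
  have "closed {x :: real ^ 'n. \<forall>i. 0 \<le> x $ i}"
    by (intro closed_Collect_all closed_Collect_le continuous_intros)
  moreover have "S1 = {x :: real ^ 'n. \<forall>i. 0 \<le> x $ i} \<inter> {x. norm1 x = 1}"
    by (auto simp: S1_def)
  ultimately show ?thesis
    using closed_Int_compact[OF _ compact_norm1_sphere] by metis
qed

lemma compact_Z1: "compact (Z1 :: (real ^ 'n::finite) set)"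
proof -
  have "closed {x :: real ^ 'n. (\<Sum>i\<in>UNIV. x $ i) = 0}"
    by (intro closed_Collect_eq continuous_intros)
  moreover have "Z1 = {x :: real ^ 'n. (\<Sum>i\<in>UNIV. x $ i) = 0} \<inter> {x. norm1 x = 1}"
    by (auto simp: Z1_def)
  ultimately show ?thesis
    using closed_Int_compact[OF _ compact_norm1_sphere] by metis
qed

lemma S1_nonempty: "(S1 :: (real ^ 'n::finite) set) \<noteq> {}"
proof -
  have "axis a 1 \<in> (S1 :: (real ^ 'n) set)" for a
    by (simp add: S1_def norm1_def axis_def if_distrib cong: if_cong)
  then show ?thesis by auto
qed

lemma Z1_nonempty:
  assumes "CARD('n::finite) \<ge> 2"
  shows "(Z1 :: (real ^ 'n) set) \<noteq> {}"
proof -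
  obtain a b :: 'n where ab: "a \<noteq> b"
    using assms by (metis (full_types) UNIV_eq_I card_2_iff' card_le_Suc0_iff_eq finite not_less_eq_eq numeral_2_eq_2 UNIV_I)
  define z :: "real ^ 'n" where "z = (\<chi> i. if i = a then 1/2 else if i = b then -1/2 else 0)"
  have 1: "z $ i = (if i = a then 1/2 else 0) + (if i = b then -1/2 else 0)" for i
    using ab by (auto simp: z_def)
  have 2: "\<bar>z $ i\<bar> = (if i = a then 1/2 else 0) + (if i = b then 1/2 else 0)" for i
    using ab by (auto simp: z_def)
  have "(\<Sum>i\<in>UNIV. z $ i) = 0"
    by (subst 1) (simp add: sum.distrib)
  moreover have "norm1 z = 1"
    unfolding norm1_def by (subst 2) (simp add: sum.distrib)
  ultimately have "z \<in> Z1"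
    by (simp add: Z1_def)
  then show ?thesis by auto
qed

lemma T_L_attained:
  fixes P :: "'n::finite tensor3"
  assumes "CARD('n) \<ge> 2"
  shows "\<exists>x\<in>S1. \<exists>y\<in>Z1. T_L P = norm1 (tensor_app P x y) \<and>
           (\<forall>x'\<in>S1. \<forall>y'\<in>Z1. norm1 (tensor_app P x' y') \<le> norm1 (tensor_app P x y))"
proof -
  define f where "f x y = norm1 (tensor_app P x y)" for x y
  define g where "g x = max_over Z1 (f x)" for x
  have contf: "continuous_on T (\<lambda>p. f (fst p) (snd p))" for T
    unfolding f_def norm1_def tensor_app_def by (simp, intro continuous_intros)
  have conty: "continuous_on Z1 (f x)" for x
    unfolding f_def norm1_def tensor_app_def by (simp, intro continuous_intros)
  have g: "\<exists>y\<in>Z1. g x = f x y \<and> (\<forall>y'\<in>Z1. f x y' \<le> f x y)" for x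
  proof -
    obtain y where "y \<in> Z1" "\<forall>y'\<in>Z1. f x y' \<le> f x y"
      using continuous_attains_sup[OF compact_Z1 Z1_nonempty[OF assms] conty] by blast
    then show ?thesis
      unfolding g_def by (intro bexI[of _ y] conjI max_over_eqI) auto
  qed
  have "\<exists>p\<in>S1 \<times> Z1. \<forall>q\<in>S1 \<times> Z1. f (fst q) (snd q) \<le> f (fst p) (snd p)"
    using S1_nonempty Z1_nonempty[OF assms]
    by (intro continuous_attains_sup compact_Times compact_S1 compact_Z1 contf) auto
  then obtain x y where xy: "x \<in> S1" "y \<in> Z1" "\<And>x' y'. x' \<in> S1 \<Longrightarrow> y' \<in> Z1 \<Longrightarrow> f x' y' \<le> f x y"
    by force
  have gx: "g x = f x y"
    using g[of x] xy by (metis order_antisym)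
  have "T_L P = max_over S1 g"
    unfolding T_L_def g_def[abs_def] f_def[abs_def] ..
  also have "\<dots> = g x"
  proof (rule max_over_eqI)
    show "g x' \<le> g x" if "x' \<in> S1" for x'
      using g[of x'] gx xy that by auto
  qed (fact xy)
  finally show ?thesis
    using xy gx unfolding f_def by metis
qed

end

theory Submission
  imports Defs
begin

text \<open>
  A vector \<open>y\<close> of \<open>Z1\<close> has positive and negative parts \<open>p\<close>, \<open>q\<close> of mass \<open>1/2\<close> each, so
  \<open>y\<close> is the combination of the differences \<open>e\<^sub>k - e\<^sub>l\<close> with the weights \<open>2 p\<^sub>k q\<^sub>l\<close>, which sum to
  \<open>1/2\<close>. By convexity the norm is thus largest at \<open>x = e\<^sub>j\<close>, \<open>y = (e\<^sub>k - e\<^sub>l)/2\<close>. For stochastic \<open>P\<close>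
  use \<open>\<bar>a - b\<bar> = a + b - 2 min a b\<close>, and choose \<open>\<I>\<close> as the set of the \<open>i\<close> at which the second
  column is the smaller one.
\<close>

text \<open>The weights \<open>p k * q l\<close> form a product, so the double sum factors: the
  terms with \<open>a k\<close> pick up \<open>sum q A\<close> and those with \<open>a l\<close>
  pick up \<open>sum p A\<close>. Both masses are 1/2, which the factor 2 cancels.\<close>

lemma sum_mult_zero_sum_eq:
  fixes a y :: "'k \<Rightarrow> real"
  assumes "finite A" and zero: "sum y A = 0" and one: "(\<Sum>k\<in>A. \<bar>y k\<bar>) = 1"
  defines "p \<equiv> \<lambda>k. max (y k) 0" and "q \<equiv> \<lambda>k. max (- y k) 0"
  shows "sum p A = 1/2" "sum q A = 1/2"
    "(\<Sum>k\<in>A. a k * y k) = 2 * (\<Sum>k\<in>A. \<Sum>l\<in>A. p k * q l * (a k - a l))"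
proof -
  have y: "y k = p k - q k" and abs_y: "\<bar>y k\<bar> = p k + q k" for k
    by (auto simp: p_def q_def)
  have "sum p A - sum q A = 0" "sum p A + sum q A = 1"
    using zero one by (simp_all add: y[symmetric] abs_y[symmetric] flip: sum_subtractf sum.distrib)
  then show sums: "sum p A = 1/2" "sum q A = 1/2"
    by linarith+
  have "(\<Sum>k\<in>A. \<Sum>l\<in>A. p k * q l * (a k - a l))
      = (\<Sum>k\<in>A. \<Sum>l\<in>A. (a k * p k) * q l) - (\<Sum>k\<in>A. \<Sum>l\<in>A. p k * (a l * q l))"
    by (simp add: algebra_simps flip: sum_subtractf)
  also have "\<dots> = (\<Sum>k\<in>A. a k * p k) * sum q A - sum p A * (\<Sum>l\<in>A. a l * q l)"
    by (simp add: sum_product)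
  finally show "(\<Sum>k\<in>A. a k * y k) = 2 * (\<Sum>k\<in>A. \<Sum>l\<in>A. p k * q l * (a k - a l))"
    by (simp add: sums y right_diff_distrib sum_subtractf)
qed

text \<open>The triangle inequality bounds the norm by a combination of distances between columns of
  \<open>a\<close>. Its weights \<open>2 * p k * q l\<close> add up to 2 * 1/2 * 1/2 = 1/2, which is
  the factor in front of \<open>M\<close>.\<close>

lemma norm1_column_combination_le:
  fixes a :: "'i::finite \<Rightarrow> 'k::finite \<Rightarrow> real" and y :: "real ^ 'k"
  assumes y: "y \<in> Z1" and M: "\<And>k l. (\<Sum>i\<in>UNIV. \<bar>a i k - a i l\<bar>) \<le> M"
  shows "(\<Sum>i\<in>UNIV. \<bar>\<Sum>k\<in>UNIV. a i k * y $ k\<bar>) \<le> M / 2"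
proof -
  define p where "p k = max (y $ k) 0" for k
  define q where "q k = max (- y $ k) 0" for k
  note decomp = sum_mult_zero_sum_eq[of UNIV "\<lambda>k. y $ k", folded p_def q_def]
  have y': "(\<Sum>k\<in>UNIV. y $ k) = 0" "(\<Sum>k\<in>UNIV. \<bar>y $ k\<bar>) = 1"
    using y by (simp_all add: Z1_def norm1_def)
  have nonneg: "0 \<le> p k * q l" for k l
    by (simp add: p_def q_def)
  have "(\<Sum>i\<in>UNIV. \<bar>\<Sum>k\<in>UNIV. a i k * y $ k\<bar>)
      \<le> (\<Sum>i\<in>UNIV. 2 * (\<Sum>k\<in>UNIV. \<Sum>l\<in>UNIV. p k * q l * \<bar>a i k - a i l\<bar>))"
  proof (rule sum_mono)
    fix i
    have "\<bar>\<Sum>k\<in>UNIV. \<Sum>l\<in>UNIV. p k * q l * (a i k - a i l)\<bar>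
        \<le> (\<Sum>k\<in>UNIV. \<Sum>l\<in>UNIV. \<bar>p k * q l * (a i k - a i l)\<bar>)"
      by (rule order_trans[OF sum_abs sum_mono[OF sum_abs]])
    also have "\<dots> = (\<Sum>k\<in>UNIV. \<Sum>l\<in>UNIV. p k * q l * \<bar>a i k - a i l\<bar>)"
      unfolding abs_mult[of "p _ * q _"] abs_of_nonneg[OF nonneg] ..
    finally show "\<bar>\<Sum>k\<in>UNIV. a i k * y $ k\<bar>
        \<le> 2 * (\<Sum>k\<in>UNIV. \<Sum>l\<in>UNIV. p k * q l * \<bar>a i k - a i l\<bar>)"
      using decomp(3)[OF _ y', of "a i"] by (simp add: abs_mult)
  qed
  \<comment> \<open>The sum over \<open>i\<close> moves inside both others, so that each pair of
    columns contributes its full distance, to which \<open>M\<close> applies.\<close>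
  also have "\<dots> = 2 * (\<Sum>k\<in>UNIV. \<Sum>l\<in>UNIV. p k * q l * (\<Sum>i\<in>UNIV. \<bar>a i k - a i l\<bar>))"
    unfolding sum_distrib_left
    by (subst sum.swap, rule sum.cong[OF refl], rule sum.swap)
  also have "\<dots> \<le> 2 * (\<Sum>k\<in>UNIV. \<Sum>l\<in>UNIV. p k * q l * M)"
    by (intro mult_left_mono sum_mono M nonneg) simp
  also have "\<dots> = 2 * (sum p UNIV * sum q UNIV * M)"
    unfolding sum_product by (simp add: sum_distrib_right)
  also have "\<dots> = M / 2"
    by (simp only: decomp(1,2)[OF finite y'])
  finally show ?thesis .
qed

text \<open>The entries of \<open>x\<close> are convex weights, so \<open>tensor_app P x y\<close>
  is a convex combination over \<open>j\<close> of the matrices \<open>P $ _ $ j $ _\<close> applied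
  to \<open>y\<close>. Each of these vectors obeys the bound for a single matrix.\<close>

lemma norm1_tensor_app_le:
  fixes P :: "'n::finite tensor3"
  assumes x: "x \<in> S1" and y: "y \<in> Z1"
    and M: "\<And>j k l. (\<Sum>i\<in>UNIV. \<bar>P $ i $ j $ k - P $ i $ j $ l\<bar>) \<le> M"
  shows "norm1 (tensor_app P x y) \<le> M / 2"
proof -
  have x0: "0 \<le> x $ j" for j
    using x by (simp add: S1_def)
  have x1: "(\<Sum>j\<in>UNIV. x $ j) = 1"
    using x x0 by (simp add: S1_def norm1_def)
  have "norm1 (tensor_app P x y)
      = (\<Sum>i\<in>UNIV. \<bar>\<Sum>j\<in>UNIV. x $ j * (\<Sum>k\<in>UNIV. P $ i $ j $ k * y $ k)\<bar>)"
    by (simp add: norm1_def tensor_app_def sum_distrib_left mult_ac)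
  also have "\<dots> \<le> (\<Sum>i\<in>UNIV. \<Sum>j\<in>UNIV. x $ j * \<bar>\<Sum>k\<in>UNIV. P $ i $ j $ k * y $ k\<bar>)"
    by (intro sum_mono order_trans[OF sum_abs]) (simp add: abs_mult x0)
  also have "\<dots> = (\<Sum>j\<in>UNIV. x $ j * (\<Sum>i\<in>UNIV. \<bar>\<Sum>k\<in>UNIV. P $ i $ j $ k * y $ k\<bar>))"
    unfolding sum_distrib_left by (rule sum.swap)
  also have "\<dots> \<le> (\<Sum>j\<in>UNIV. x $ j * (M / 2))"
    by (intro sum_mono mult_left_mono norm1_column_combination_le y M x0)
  also have "\<dots> = M / 2"
    by (simp add: x1 flip: sum_distrib_right sum_divide_distrib)
  finally show ?thesis .
qed

lemma axis_in_S1: "axis j 1 \<in> S1"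
  by (simp add: S1_def norm1_def axis_def if_distrib cong: if_cong)

lemma half_axis_diff_in_Z1:
  assumes "k \<noteq> l"
  shows "(1/2) *\<^sub>R (axis k 1 - axis l 1) \<in> Z1"
proof -
  let ?z = "(1/2) *\<^sub>R (axis k 1 - axis l 1) :: real ^ 'a"
  \<comment> \<open>Since \<open>k \<noteq> l\<close>, the two axis vectors have disjoint supports
    and nothing cancels.\<close>
  have abs: "\<bar>?z $ i\<bar> = axis k (1/2) $ i + axis l (1/2) $ i" for i
    using assms by (simp add: axis_def)
  have val: "?z $ i = axis k (1/2) $ i - axis l (1/2) $ i" for i
    by (simp add: axis_def)
  have half: "(\<Sum>i\<in>UNIV. axis m (1/2) $ i) = (1/2 :: real)" for m :: 'a
    by (simp add: axis_def)
  have "(\<Sum>i\<in>UNIV. ?z $ i) = 1/2 - 1/2"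
    unfolding val sum_subtractf half ..
  moreover have "(\<Sum>i\<in>UNIV. \<bar>?z $ i\<bar>) = 1/2 + 1/2"
    unfolding abs sum.distrib half ..
  ultimately show ?thesis
    by (simp add: Z1_def norm1_def)
qed

lemma sum_mult_axis:
  fixes a :: "'k::finite \<Rightarrow> real"
  shows "(\<Sum>m\<in>UNIV. a m * axis k 1 $ m) = a k"
  by (simp add: axis_def mult_delta_right)

text \<open>These test vectors realise every candidate of the maximum over \<open>j\<close>,
  \<open>k\<close>, \<open>l\<close>, which shows that the upper bound is sharp.\<close>

lemma norm1_tensor_app_axis:
  "norm1 (tensor_app P (axis j 1) ((1/2) *\<^sub>R (axis k 1 - axis l 1)))
    = 1/2 * (\<Sum>i\<in>UNIV. \<bar>P $ i $ j $ k - P $ i $ j $ l\<bar>)"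
proof -
  have app: "tensor_app P (axis j 1) y $ i = (\<Sum>m\<in>UNIV. P $ i $ j $ m * y $ m)" for y i
  proof -
    have "tensor_app P (axis j 1) y $ i
        = (\<Sum>h\<in>UNIV. (\<Sum>m\<in>UNIV. P $ i $ h $ m * y $ m) * axis j 1 $ h)"
      by (simp add: tensor_app_def sum_distrib_left mult_ac)
    then show ?thesis
      by (simp only: sum_mult_axis)
  qed
  have diff: "tensor_app P (axis j 1) ((1/2) *\<^sub>R (axis k 1 - axis l 1)) $ i
      = 1/2 * (P $ i $ j $ k - P $ i $ j $ l)" for i
  proof -
    have "tensor_app P (axis j 1) ((1/2) *\<^sub>R (axis k 1 - axis l 1)) $ i
        = 1/2 * ((\<Sum>m\<in>UNIV. P $ i $ j $ m * axis k 1 $ m)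
          - (\<Sum>m\<in>UNIV. P $ i $ j $ m * axis l 1 $ m))"
      unfolding app sum_distrib_left sum_subtractf[symmetric]
      by (rule sum.cong) (simp_all add: algebra_simps)
    then show ?thesis
      by (simp only: sum_mult_axis)
  qed
  show ?thesis
    unfolding norm1_def diff abs_mult sum_distrib_left by simp
qed

lemma T_L_eq_Max:
  fixes P :: "'n::finite tensor3"
  assumes "CARD('n) \<ge> 2"
  shows "T_L P = 1/2 * (MAX (j, k1, k2)\<in>UNIV. \<Sum>i\<in>UNIV. \<bar>P $ i $ j $ k1 - P $ i $ j $ k2\<bar>)"
    (is "_ = 1/2 * ?M")
proof -
  \<comment> \<open>An attained joint maximum replaces the nested \<open>GREATEST\<close> of
    \<open>T_L\<close>: the upper bound is applied to the maximiser, and the lower bound compares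
    the maximiser with axis vectors.\<close>
  obtain x y where xy: "x \<in> S1" "y \<in> Z1" "T_L P = norm1 (tensor_app P x y)"
    and max: "\<And>x' y'. x' \<in> S1 \<Longrightarrow> y' \<in> Z1 \<Longrightarrow> norm1 (tensor_app P x' y') \<le> T_L P"
    using T_L_attained[OF assms, of P] by auto
  have "(\<Sum>i\<in>UNIV. \<bar>P $ i $ j $ k - P $ i $ j $ l\<bar>) \<le> ?M" for j k l
    by (rule Max_ge) (auto intro!: image_eqI[of _ _ "(j, k, l)"])
  from norm1_tensor_app_le[OF xy(1,2) this] have le: "T_L P \<le> 1/2 * ?M"
    by (simp add: xy(3))
  have "(\<Sum>i\<in>UNIV. \<bar>P $ i $ j $ k - P $ i $ j $ l\<bar>) \<le> 2 * T_L P" for j k l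
  \<comment> \<open>For \<open>k = l\<close> the test vector would be zero, hence outside
    \<open>Z1\<close>. There the distance is 0, and \<open>T_L P\<close> is nonnegative as the value
    of a norm.\<close>
  proof (cases "k = l")
    case True
    then show ?thesis
      by (simp add: xy(3) norm1_def sum_nonneg)
  next
    case False
    from max[OF axis_in_S1 half_axis_diff_in_Z1[OF this], of j]
    show ?thesis
      by (simp add: norm1_tensor_app_axis)
  qed
  then have "?M \<le> 2 * T_L P"
    by (intro Max.boundedI) auto
  with le show ?thesis
    by linarith
qed

text \<open>The overlap of two probability vectors is one minus their total variation distance; each
  column contributes half of its mass 1.\<close>

lemma stochastic_overlap:
  assumes "stochastic P"
  shows "(\<Sum>i\<in>UNIV. min (P $ i $ j $ k) (P $ i $ j $ l))
    = 1 - 1/2 * (\<Sum>i\<in>UNIV. \<bar>P $ i $ j $ k - P $ i $ j $ l\<bar>)"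
proof -
  have "min a b = 1/2 * a + 1/2 * b - 1/2 * \<bar>a - b\<bar>" for a b :: real
    by (simp add: min_def abs_if field_simps)
  then have "(\<Sum>i\<in>UNIV. min (P $ i $ j $ k) (P $ i $ j $ l))
      = 1/2 * (\<Sum>i\<in>UNIV. P $ i $ j $ k) + 1/2 * (\<Sum>i\<in>UNIV. P $ i $ j $ l)
        - 1/2 * (\<Sum>i\<in>UNIV. \<bar>P $ i $ j $ k - P $ i $ j $ l\<bar>)"
    by (simp only: sum.distrib sum_subtractf sum_distrib_left)
  then show ?thesis
    using assms by (simp add: stochastic_def)
qed

lemma Min_diff_Max:
  fixes f :: "'a \<Rightarrow> real"
  assumes "finite A" "A \<noteq> {}"
  shows "(MIN x\<in>A. c - f x) = c - (MAX x\<in>A. f x)"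
proof (rule Min_eqI)
  have "Max (f ` A) \<in> f ` A"
    by (rule Max_in) (use assms in auto)
  then obtain x where "x \<in> A" and x: "Max (f ` A) = f x"
    by blast
  then show "c - Max (f ` A) \<in> (\<lambda>x. c - f x) ` A"
    unfolding x by (intro imageI)
qed (use assms in auto)

text \<open>A set \<open>I\<close> decides for each \<open>i\<close> which of the two columns
  supplies the entry, and the best decision yields the entrywise minimum. For fixed \<open>I\<close>
  and \<open>j\<close> the two sums share no column index, so \<open>k1\<close> and
  \<open>k2\<close> can be minimised separately.\<close>

lemma Min_sum_split_eq:
  fixes f :: "'i::finite \<Rightarrow> 'j::finite \<Rightarrow> 'k::finite \<Rightarrow> real"
  shows "(MIN I\<in>(UNIV :: 'i set set). MIN j\<in>UNIV.
            ((MIN k1\<in>UNIV. \<Sum>i\<in>-I. f i j k1) + (MIN k2\<in>UNIV. \<Sum>i\<in>I. f i j k2)))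
       = (MIN (j, k1, k2)\<in>UNIV. \<Sum>i\<in>UNIV. min (f i j k1) (f i j k2))"
    (is "(MIN I\<in>_. MIN j\<in>_. ?g I j) = ?m")
proof (rule antisym)
  have split: "(\<Sum>i\<in>UNIV. h i) = (\<Sum>i\<in>-I. h i) + (\<Sum>i\<in>I. h i)" for h :: "'i \<Rightarrow> real" and I
    by (metis sum.subset_diff[OF subset_UNIV finite] Compl_eq_Diff_UNIV)
  show "(MIN I\<in>UNIV. MIN j\<in>UNIV. ?g I j) \<le> ?m"
  proof (rule Min.boundedI)
    fix v assume "v \<in> (\<lambda>(j, k1, k2). \<Sum>i\<in>UNIV. min (f i j k1) (f i j k2)) ` UNIV"
    then obtain j k1 k2 where v: "v = (\<Sum>i\<in>UNIV. min (f i j k1) (f i j k2))"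
      by auto
    \<comment> \<open>The optimal decision for this triple; ties fall into \<open>-I\<close>, where
      both entries agree.\<close>
    define I where "I = {i. f i j k2 < f i j k1}"
    have "(MIN I\<in>UNIV. MIN j\<in>UNIV. ?g I j) \<le> (MIN j\<in>UNIV. ?g I j)"
      by (rule Min_le) auto
    also have "\<dots> \<le> ?g I j"
      by (rule Min_le) auto
    also have "\<dots> \<le> (\<Sum>i\<in>-I. f i j k1) + (\<Sum>i\<in>I. f i j k2)"
      by (intro add_mono Min_le) auto
    also have "\<dots> = v"
      unfolding v split[of _ I]
      by (intro arg_cong2[where f = "(+)"] sum.cong) (auto simp: I_def)
    finally show "(MIN I\<in>UNIV. MIN j\<in>UNIV. ?g I j) \<le> v" .
  qed auto
  \<comment> \<open>Conversely, with \<open>k1\<close> and \<open>k2\<close> attaining the inner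
    minima, the entrywise minimum is below whichever entry \<open>I\<close> selects.\<close>
  have "?m \<le> ?g I j" for I j
  proof -
    have attained: "\<exists>k. Min (range h) = h k" for h :: "'k \<Rightarrow> real"
    proof -
      have "Min (range h) \<in> range h"
        by (rule Min_in) auto
      then show ?thesis
        by blast
    qed
    obtain k1 where k1: "(MIN k\<in>UNIV. \<Sum>i\<in>-I. f i j k) = (\<Sum>i\<in>-I. f i j k1)"
      using attained by blast
    obtain k2 where k2: "(MIN k\<in>UNIV. \<Sum>i\<in>I. f i j k) = (\<Sum>i\<in>I. f i j k2)"
      using attained by blast
    have "?m \<le> (\<Sum>i\<in>UNIV. min (f i j k1) (f i j k2))"
      by (rule Min_le) (auto intro!: image_eqI[of _ _ "(j, k1, k2)"])
    also have "\<dots> \<le> ?g I j"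
      unfolding k1 k2 split[of _ I] by (intro add_mono sum_mono) auto
    finally show ?thesis .
  qed
  then show "?m \<le> (MIN I\<in>UNIV. MIN j\<in>UNIV. ?g I j)"
    by (intro Min.boundedI) (auto intro!: Min.boundedI)
qed

theorem theorem5p1:
  fixes P :: "'n::finite tensor3"
  assumes "CARD('n) \<ge> 2"
  shows "T_L P =
           1/2 * (MAX (j, k1, k2)\<in>UNIV. \<Sum>i\<in>UNIV. \<bar>P $ i $ j $ k1 - P $ i $ j $ k2\<bar>)
       \<and> (stochastic P \<longrightarrow>
            T_L P = 1 - (MIN (j, k1, k2)\<in>UNIV. \<Sum>i\<in>UNIV. min (P $ i $ j $ k1) (P $ i $ j $ k2))
          \<and> T_L P = 1 - (MIN I\<in>(UNIV :: 'n set set). MIN j\<in>UNIV.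
                ((MIN k1\<in>UNIV. \<Sum>i\<in>-I. P $ i $ j $ k1)
               + (MIN k2\<in>UNIV. \<Sum>i\<in>I. P $ i $ j $ k2))))"
proof -
  have "T_L P = 1 - (MIN (j, k1, k2)\<in>UNIV. \<Sum>i\<in>UNIV. min (P $ i $ j $ k1) (P $ i $ j $ k2))"
    (is "_ = 1 - ?m") if "stochastic P"
  proof -
    let ?D = "\<lambda>(j, k1, k2). \<Sum>i\<in>UNIV. \<bar>P $ i $ j $ k1 - P $ i $ j $ k2\<bar>"
    \<comment> \<open>The smallest overlap belongs to the pair of columns farthest apart, so the
      minimum turns into the maximum already computed.\<close>
    have "?m = (MIN t\<in>UNIV. 1 - 1/2 * ?D t)"
      by (rule arg_cong[where f = Min], rule image_cong)
        (auto simp: stochastic_overlap[OF that])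
    also have "\<dots> = 1 - (MAX t\<in>UNIV. 1/2 * ?D t)"
      by (rule Min_diff_Max) auto
    also have "(MAX t\<in>UNIV. 1/2 * ?D t) = 1/2 * (MAX t\<in>UNIV. ?D t)"
      using mono_Max_commute[of "\<lambda>v::real. 1/2 * v" "range ?D"]
      by (simp add: mono_def image_image)
    finally show ?thesis
      using T_L_eq_Max[OF assms, of P] by simp
  qed
  then show ?thesis
    unfolding Min_sum_split_eq[of "\<lambda>i j k. P $ i $ j $ k"]
    using T_L_eq_Max[OF assms, of P] by blast
qed

end
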